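(* Let $n \ge k \ge 1$ be integers. For every $\underline{x} = (x_1,\dots,x_n)$ with $x_i\ge 0$ for all $i$, $$\lim_{m\to\infty} \mathsf{sym}_{km}\big(\underline{x}^{(m)}\big) = \mathsf{hsm}_{k/n}(\underline{x}) .$$ Furthermore, the relative error goes to zero uniformly with respect to the $x_i$'s: for every $\varepsilon>0$ there exists $M$ such that for all $m\ge M$ and all $\underline{x}\in[0,\infty)^n$, $$\left|\mathsf{sym}_{km}\big(\underline{x}^{(m)}\big) - \mathsf{hsm}_{k/n}(\underline{x})\right| \le \varepsilon\, \mathsf{hsm}_{k/n}(\underline{x}).$$
   Context: Conventions: $\log 0 = -\infty$, $\exp(-\infty)=0$, $\exp(+\infty)=+\infty$. Halász–Székely (HS) kernel: for $x\in[0,\infty)$, $y\in(0,\infty)$, $c\in[0,1]$, $$K(x,y,c) = \begin{cases}\log y + c^{-1}\log(c y^{-1}x + 1 - c) & c>0,\\ \log y + y^{-1}x - 1 & c=0.\end{cases}$$ For a Borel probability measure $\mu$ on $[0,\infty)$ and $c\in[0,1]$ (if $c=1$, assume that $\log x$ is semi-integrable with respect to $\mu$, i.e. its positive part or its negative part is $\mu$-integrable), the HS barycenter is $$[\mu]_c = \exp \inf_{y>0}\int K(x,y,c)\,d\mu(x) \in [0,+\infty].$$ For a tuple $\underline{x}=(x_1,\dots,x_n)$ of nonnegative numbers, the HS mean is $\mathsf{hsm}_c(\underline{x}) = \left[\frac{\delta_{x_1}+\dots+\delta_{x_n}}{n}\right]_c$, where $\delta_x$ is the unit mass at $x$. The $k$-th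 symmetric mean of an $n$-tuple ($1\le k\le n$) is $\mathsf{sym}_k(\underline{x}) = \left( E_k^{(n)}(\underline{x}) / \binom{n}{k}\right)^{1/k}$, where $E_k^{(n)}(\underline{x})=\sum_{i_1<\dots<i_k} x_{i_1}\cdots x_{i_k}$ is the elementary symmetric polynomial of degree $k$. For $m\ge1$, $\underline{x}^{(m)}$ denotes the $nm$-tuple obtained by concatenating $m$ copies of the $n$-tuple $\underline{x}$. *)

theory Defs
  imports "HOL-Probability.Probability"
begin

text \<open>Logarithm and exponential with the conventions
  log 0 = -\<infinity>, exp (-\<infinity>) = 0 and exp (+\<infinity>) = +\<infinity>.
  The logarithm is only ever applied to nonnegative reals.\<close>

definition ext_ln :: "real \<Rightarrow> ereal" where
  "ext_ln x = (if x = 0 then -\<infinity> else ereal (ln x))"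

definition ext_exp :: "ereal \<Rightarrow> ereal" where
  "ext_exp z = (if z = \<infinity> then \<infinity> else if z = -\<infinity> then 0 else ereal (exp (real_of_ereal z)))"

text \<open>Integral of an extended-real-valued function as the integral of its positive part minus
  the integral of its negative part (e2ennreal sends negative numbers to 0).  It is the
  usual integral when f is semi-integrable, i.e. when at least one of the two terms is finite.\<close>

definition ext_integral :: "'a measure \<Rightarrow> ('a \<Rightarrow> ereal) \<Rightarrow> ereal" where
  "ext_integral M f =
     enn2ereal (\<integral>\<^sup>+ x. e2ennreal (f x) \<partial>M) - enn2ereal (\<integral>\<^sup>+ x. e2ennreal (- f x) \<partial>M)"

text \<open>Meaningful for 0 \<le> x, 0 < y and 0 \<le> c \<le> 1.  The argument of the logarithm vanishes
  exactly when c = 1 and x = 0.\<close>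

definition HS_kernel :: "real \<Rightarrow> real \<Rightarrow> real \<Rightarrow> ereal" where
  "HS_kernel x y c =
     (if c > 0 then ereal (ln y) + ereal (inverse c) * ext_ln (c * inverse y * x + 1 - c)
      else ereal (ln y + inverse y * x - 1))"

text \<open>Meaningful for Borel probability measures on the reals that are concentrated on the
  nonnegative half-line, and 0 \<le> c \<le> 1; if c = 1, the logarithm has to be semi-integrable.\<close>

definition HS_barycenter :: "real measure \<Rightarrow> real \<Rightarrow> ereal" where
  "HS_barycenter \<mu> c = ext_exp (INF y\<in>{0<..}. ext_integral \<mu> (\<lambda>x. HS_kernel x y c))"

text \<open>The normalised sum of the unit masses at the entries of a nonempty list.\<close>

definition empirical_measure :: "real list \<Rightarrow> real measure" where
  "empirical_measure xs = measure_of UNIV (sets borel)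
     (\<lambda>A. (\<Sum>x\<leftarrow>xs. emeasure (return borel x) A) / of_nat (length xs))"

definition HS_mean :: "real \<Rightarrow> real list \<Rightarrow> ereal" where
  "HS_mean c xs = HS_barycenter (empirical_measure xs) c"

definition elem_sym :: "nat \<Rightarrow> real list \<Rightarrow> real" where
  "elem_sym k xs = (\<Sum>I | I \<subseteq> {..<length xs} \<and> card I = k. \<Prod>i\<in>I. xs ! i)"

definition sym_mean :: "nat \<Rightarrow> real list \<Rightarrow> real" where
  "sym_mean k xs = root k (elem_sym k xs / real (length xs choose k))"

definition repeat_tuple :: "nat \<Rightarrow> 'a list \<Rightarrow> 'a list" where
  "repeat_tuple m xs = concat (replicate m xs)"


lemma nth_measurable_uniform_count_measure:
  "(!) xs \<in> uniform_count_measure {..<length xs} \<rightarrow>\<^sub>M borel"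
  by (auto simp: measurable_def sets_uniform_count_measure space_uniform_count_measure)

lemma emeasure_distr_nth:
  fixes xs :: "real list"
  assumes "xs \<noteq> []" and A: "A \<in> sets borel"
  shows "emeasure (distr (uniform_count_measure {..<length xs}) borel ((!) xs)) A
       = (\<Sum>x\<leftarrow>xs. emeasure (return borel x) A) / of_nat (length xs)"
    (is "emeasure ?N A = _")
proof -
  let ?B = "{i. i < length xs \<and> xs ! i \<in> A}"
  have "(\<Sum>x\<leftarrow>xs. emeasure (return borel x) A) = (\<Sum>i<length xs. indicator A (xs ! i))"
    using A by (simp add: sum_list_sum_nth atLeast0LessThan)
  also have "\<dots> = (\<Sum>i\<in>?B. 1)"
    by (rule sum.mono_neutral_cong_right) (auto simp: indicator_def)
  finally have s: "(\<Sum>x\<leftarrow>xs. emeasure (return borel x) A) = of_nat (card ?B)"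
    by simp
  have "emeasure ?N A = emeasure (uniform_count_measure {..<length xs}) ?B"
    using A nth_measurable_uniform_count_measure by (subst emeasure_distr)
      (auto simp: space_uniform_count_measure intro!: arg_cong2[where f=emeasure])
  also have "\<dots> = ennreal (real (card ?B) / real (length xs))"
    by (subst emeasure_uniform_count_measure) auto
  also have "\<dots> = of_nat (card ?B) / of_nat (length xs)"
    using assms by (simp add: divide_ennreal[symmetric] ennreal_of_nat_eq_real_of_nat)
  finally show ?thesis using s by simp
qed

lemma empirical_measure_eq_distr:
  assumes "xs \<noteq> []"
  shows "empirical_measure xs = distr (uniform_count_measure {..<length xs}) borel ((!) xs)"
    (is "_ = ?N")
proof -
  have "?N = measure_of (space ?N) (sets ?N) (emeasure ?N)"
    by (simp only: measure_of_of_measure)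
  also have "\<dots> = measure_of UNIV (sets borel) (emeasure ?N)" by simp
  also have "\<dots> = empirical_measure xs"
    unfolding empirical_measure_def
    using sets.sigma_sets_eq[of "borel :: real measure"]
    by (intro measure_of_eq) (auto simp: emeasure_distr_nth[OF assms])
  finally show ?thesis by simp
qed

lemma sets_empirical_measure [simp, measurable_cong]:
  "sets (empirical_measure xs) = sets borel"
  unfolding empirical_measure_def
  using sets.sigma_sets_eq[of "borel :: real measure"] by simp

lemma emeasure_empirical_measure:
  assumes "xs \<noteq> []" "A \<in> sets borel"
  shows "emeasure (empirical_measure xs) A =
           (\<Sum>x\<leftarrow>xs. emeasure (return borel x) A) / of_nat (length xs)"
  using emeasure_distr_nth[OF assms] by (simp only: empirical_measure_eq_distr[OF assms(1)])

lemma nn_integral_empirical_measure: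
  assumes "xs \<noteq> []" and [measurable]: "f \<in> borel_measurable borel"
  shows "(\<integral>\<^sup>+ x. f x \<partial>empirical_measure xs) = (\<Sum>x\<leftarrow>xs. f x) / of_nat (length xs)"
proof -
  have "(\<integral>\<^sup>+ x. f x \<partial>empirical_measure xs)
      = (\<integral>\<^sup>+ i. f (xs ! i) \<partial>uniform_count_measure {..<length xs})"
    using nth_measurable_uniform_count_measure[of xs] assms by (simp add: empirical_measure_eq_distr nn_integral_distr)
  also have "\<dots> = (\<Sum>i<length xs. f (xs ! i) * (1 / of_nat (length xs)))"
    unfolding uniform_count_measure_def using assms(1)
    by (subst nn_integral_point_measure_finite)
       (auto simp: mult.commute divide_ennreal[symmetric] ennreal_of_nat_eq_real_of_nat)
  also have "\<dots> = (\<Sum>x\<leftarrow>xs. f x) / of_nat (length xs)"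
    by (simp add: sum_list_sum_nth atLeast0LessThan divide_ennreal_def sum_distrib_right)
  finally show ?thesis .
qed

lemma prob_space_empirical_measure: "xs \<noteq> [] \<Longrightarrow> prob_space (empirical_measure xs)"
proof
  assume "xs \<noteq> []"
  moreover have "space (empirical_measure xs) = UNIV"
    using sets_eq_imp_space_eq[OF sets_empirical_measure] by simp
  moreover have "(\<Sum>x\<leftarrow>xs. (1::ennreal)) = of_nat (length xs)"
    by (induction xs) auto
  ultimately show "emeasure (empirical_measure xs) (space (empirical_measure xs)) = 1"
    using of_nat_less_top[of "length xs"]
    by (simp add: emeasure_empirical_measure ennreal_divide_self del: of_nat_less_top)
qed

lemma HS_kernel_measurable [measurable]: "(\<lambda>x. HS_kernel x y c) \<in> borel_measurable borel"
  unfolding HS_kernel_def ext_ln_def by measurable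

text \<open>HS means of tuples are finite, so that estimates relative to them have content.\<close>

lemma HS_mean_nonneg_finite:
  assumes "xs \<noteq> []"
  shows "0 \<le> HS_mean c xs" "HS_mean c xs < \<infinity>"
proof -
  let ?M = "empirical_measure xs"
  have exp_nonneg: "0 \<le> ext_exp z" for z by (simp add: ext_exp_def)
  have exp_fin: "z < \<infinity> \<Longrightarrow> ext_exp z < \<infinity>" for z by (auto simp: ext_exp_def)
  show "0 \<le> HS_mean c xs"
    unfolding HS_mean_def HS_barycenter_def by (rule exp_nonneg)
  have K: "e2ennreal (HS_kernel x 1 c) < top" for x
    by (auto simp: HS_kernel_def ext_ln_def e2ennreal_neg)
  have L: "(\<Sum>x\<leftarrow>ys. e2ennreal (HS_kernel x 1 c)) < top" for ys
    using K by (induction ys) (auto simp: less_top)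
  have "(\<integral>\<^sup>+ x. e2ennreal (HS_kernel x 1 c) \<partial>?M)
      = (\<Sum>x\<leftarrow>xs. e2ennreal (HS_kernel x 1 c)) / of_nat (length xs)"
    using assms by (intro nn_integral_empirical_measure) auto
  also have "\<dots> < top"
    using L[of xs] assms by (simp add: ennreal_divide_eq_top_iff less_top[symmetric])
  finally have P: "(\<integral>\<^sup>+ x. e2ennreal (HS_kernel x 1 c) \<partial>?M) < top" .
  have "ext_integral ?M (\<lambda>x. HS_kernel x 1 c)
      \<le> enn2ereal (\<integral>\<^sup>+ x. e2ennreal (HS_kernel x 1 c) \<partial>?M) - 0"
    unfolding ext_integral_def by (intro ereal_minus_mono) auto
  also have "\<dots> < \<infinity>"
    using P by (cases "\<integral>\<^sup>+ x. e2ennreal (HS_kernel x 1 c) \<partial>?M") auto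
  finally have "ext_integral ?M (\<lambda>x. HS_kernel x 1 c) < \<infinity>" .
  moreover have "(INF y\<in>{0<..}. ext_integral ?M (\<lambda>x. HS_kernel x y c))
      \<le> ext_integral ?M (\<lambda>x. HS_kernel x 1 c)"
    by (rule INF_lower) simp
  ultimately show "HS_mean c xs < \<infinity>"
    unfolding HS_mean_def HS_barycenter_def by (intro exp_fin) (rule le_less_trans)
qed

end

theory Submission
  imports Defs
begin

text \<open>Put \<open>c = k / n\<close>, \<open>N = nm\<close>, \<open>K = km\<close> and \<open>F(y) = \<Prod> (c x\<^sub>i + (1 - c) y) / y\<^bsup>n-k\<^esup>\<close>. The \<open>k\<close>-th power
  of the HS mean is the infimum of \<open>F\<close> over \<open>y > 0\<close>. Expanding \<open>F\<^sup>m\<close> gives a sum of \<open>N + 1\<close> nonnegative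
  terms, one of which, \<open>E\<^sub>K c\<^sup>K (1 - c)\<^bsup>N-K\<^esup>\<close>, does not depend on \<open>y\<close>, where \<open>E\<^sub>j\<close> are the elementary
  symmetric polynomials of the repeated tuple. This term is at most \<open>inf F\<^sup>m\<close>; since \<open>E\<^sub>j\<close> is
  log-concave in \<open>j\<close>, some \<open>y\<close> makes it the largest one, so it is at least \<open>inf F\<^sup>m / (N + 1)\<close>.
  Comparing with the tuple of ones, for which the term is the binomial probability of \<open>K\<close>, the
  two means agree up to a factor \<open>(N + 1)\<^bsup>1/K\<^esup>\<close>, which tends to 1 and does not depend on the tuple.\<close>

section \<open>Elementary symmetric polynomials: recursion, generating polynomial,
  log-concavity\<close>

lemma elem_sym_0: "elem_sym 0 xs = 1"
proof -
  have "{I. I \<subseteq> {..<length xs} \<and> card I = 0} = {{}}"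
    by (auto dest: finite_subset)
  then show ?thesis by (simp only: elem_sym_def) simp
qed

lemma elem_sym_nonneg: "\<forall>x\<in>set xs. 0 \<le> x \<Longrightarrow> 0 \<le> elem_sym k xs"
  unfolding elem_sym_def by (intro sum_nonneg prod_nonneg) (auto simp: subset_iff)

text \<open>The index sets split according to whether they contain 0, the position of
  \<open>x\<close>; the remaining indices are shifted by \<open>Suc\<close>.\<close>

lemma elem_sym_Cons:
  "elem_sym (Suc k) (x # xs) = elem_sym (Suc k) xs + x * elem_sym k xs"
proof -
  let ?N = "length xs"
  let ?S = "\<lambda>n k. {I. I \<subseteq> {..<n} \<and> card I = k}"
  let ?g = "\<lambda>I. insert 0 (Suc ` I)"
  have fin: "finite (?S n k)" for n k :: nat
    by (rule finite_subset[of _ "Pow {..<n}"]) auto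
  have finI: "finite I" if "I \<subseteq> {..<?N}" for I
    using that finite_subset by blast
  have split: "?S (Suc ?N) (Suc k) = (`) Suc ` ?S ?N (Suc k) \<union> ?g ` ?S ?N k" (is "?L = ?R")
  proof
    show "?R \<subseteq> ?L"
      by (auto simp: card_image card_insert_if finI)
    show "?L \<subseteq> ?R"
    proof
      fix I assume I: "I \<in> ?L"
      define J where "J = Suc -` I"
      have J: "J \<subseteq> {..<?N}" using I by (auto simp: J_def)
      show "I \<in> ?R"
      proof (cases "0 \<in> I")
        case True
        have eq: "I = ?g J"
        proof (rule set_eqI)
          show "i \<in> I \<longleftrightarrow> i \<in> ?g J" for i
            using True by (cases i) (auto simp: J_def)
        qed
        then have "card I = Suc (card J)" using finI[OF J] by (simp add: card_image)
        with I J have "J \<in> ?S ?N k" by simp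
        then show ?thesis by (rule UnI2[OF image_eqI[of _ ?g, OF eq]])
      next
        case False
        have eq: "I = Suc ` J"
        proof (rule set_eqI)
          show "i \<in> I \<longleftrightarrow> i \<in> Suc ` J" for i
            using False by (cases i) (auto simp: J_def)
        qed
        then have "card I = card J" by (simp add: card_image)
        with I J have "J \<in> ?S ?N (Suc k)" by simp
        then show ?thesis by (rule UnI1[OF image_eqI[of _ "(`) Suc", OF eq]])
      qed
    qed
  qed
  have inj1: "inj_on ((`) Suc) (?S ?N (Suc k))"
    by (meson inj_Suc inj_image_eq_iff inj_onI)
  have inj2: "inj_on ?g (?S ?N k)"
  proof (rule inj_onI)
    fix I J assume "?g I = ?g J"
    then have "Suc ` I = Suc ` J" by auto
    then show "I = J" by (simp add: inj_image_eq_iff)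
  qed
  have "elem_sym (Suc k) (x # xs) =
      (\<Sum>I\<in>(`) Suc ` ?S ?N (Suc k). \<Prod>i\<in>I. (x # xs) ! i) + (\<Sum>I\<in>?g ` ?S ?N k. \<Prod>i\<in>I. (x # xs) ! i)"
    unfolding elem_sym_def length_Cons split using fin by (intro sum.union_disjoint) auto
  also have "(\<Sum>I\<in>(`) Suc ` ?S ?N (Suc k). \<Prod>i\<in>I. (x # xs) ! i) = elem_sym (Suc k) xs"
    by (subst sum.reindex[OF inj1]) (simp add: elem_sym_def prod.reindex)
  also have "(\<Sum>I\<in>?g ` ?S ?N k. \<Prod>i\<in>I. (x # xs) ! i) = (\<Sum>I\<in>?S ?N k. x * (\<Prod>i\<in>I. xs ! i))"
  proof (subst sum.reindex[OF inj2], rule sum.cong)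
    fix I assume "I \<in> ?S ?N k"
    then have "finite (Suc ` I)" using finI by auto
    then show "((\<lambda>I. \<Prod>i\<in>I. (x # xs) ! i) \<circ> ?g) I = x * (\<Prod>i\<in>I. xs ! i)"
      by (simp add: prod.reindex)
  qed simp
  finally show ?thesis by (simp add: elem_sym_def sum_distrib_left)
qed

lemma elem_sym_eq_0: "length xs < k \<Longrightarrow> elem_sym k xs = 0"
proof -
  assume "length xs < k"
  then have "{I. I \<subseteq> {..<length xs} \<and> card I = k} = {}"
    by (auto dest: card_mono[OF finite_lessThan])
  then show ?thesis by (simp only: elem_sym_def) simp
qed

text \<open>Keeping both \<open>s\<close> and \<open>u\<close> makes the identity homogeneous and
  admits \<open>u = 0\<close>, where only the top term survives.\<close>

lemma prod_list_eq_sum_elem_sym: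
  fixes s u :: real
  shows "(\<Prod>x\<leftarrow>xs. s * x + u) =
    (\<Sum>j\<le>length xs. elem_sym j xs * s ^ j * u ^ (length xs - j))"
proof (induction xs)
  case Nil
  then show ?case by (simp add: elem_sym_0)
next
  case (Cons x xs)
  let ?N = "length xs"
  let ?t = "\<lambda>j. elem_sym j xs * s ^ j * u ^ (?N - j)"
  have "(\<Sum>j\<le>length (x # xs). elem_sym j (x # xs) * s ^ j * u ^ (length (x # xs) - j))
      = u ^ Suc ?N + (\<Sum>j\<le>?N. elem_sym (Suc j) xs * s ^ Suc j * u ^ (?N - j)) + s * x * sum ?t {..?N}"
    by (simp add: sum.atMost_Suc_shift elem_sym_0 elem_sym_Cons sum_distrib_left
        sum.distrib[symmetric] algebra_simps del: sum.atMost_Suc)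
  also have "u ^ Suc ?N + (\<Sum>j\<le>?N. elem_sym (Suc j) xs * s ^ Suc j * u ^ (?N - j))
      = (\<Sum>j\<le>Suc ?N. elem_sym j xs * s ^ j * u ^ (Suc ?N - j))"
    by (simp add: sum.atMost_Suc_shift elem_sym_0 del: sum.atMost_Suc)
  also have "\<dots> = u * sum ?t {..?N}"
    by (simp add: elem_sym_eq_0 sum_distrib_left Suc_diff_le mult_ac)
  finally show ?case using Cons.IH by (simp add: algebra_simps)
qed

text \<open>Adding an entry \<open>x\<close> turns the difference of the two sides into a quadratic
  polynomial in \<open>x\<close>, each of whose coefficients is nonnegative by induction. Arbitrary
  gaps between \<open>i\<close> and \<open>j\<close> are allowed because the coefficient of
  \<open>x\<close> compares a wider pair of indices.\<close>

lemma elem_sym_log_concave: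
  assumes "\<forall>x\<in>set xs. 0 \<le> x" "i \<le> j"
  shows "elem_sym i xs * elem_sym (Suc j) xs \<le> elem_sym (Suc i) xs * elem_sym j xs"
  using assms
proof (induction xs arbitrary: i j)
  case Nil
  then show ?case by (simp add: elem_sym_eq_0)
next
  case (Cons x xs)
  let ?a = "\<lambda>i. elem_sym i xs"
  have x: "0 \<le> x" using Cons.prems by auto
  have a: "0 \<le> ?a i" for i using Cons.prems by (intro elem_sym_nonneg) auto
  have IH: "?a i * ?a (Suc j) \<le> ?a (Suc i) * ?a j" if "i \<le> j" for i j
    using Cons that by auto
  show ?case
  proof (cases j)
    case 0
    then show ?thesis using Cons.prems by simp
  next
    case (Suc j')
    show ?thesis
    proof (cases i)
      \<comment> \<open>The recursion \<open>elem_sym_Cons\<close> does not reach index 0, so this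
        case is expanded by hand.\<close>
      case 0
      have "0 \<le> x * ?a 1 * ?a j' + x * x * ?a j'" using a[of 1] a[of j'] x by simp
      then show ?thesis using IH[of 0 j] Suc 0
        by (simp add: elem_sym_Cons elem_sym_0 algebra_simps)
    next
      case i: (Suc i')
      \<comment> \<open>For \<open>i = j\<close> both sides coincide; otherwise
        \<open>?a i * ?a j\<close> lies between them.\<close>
      have mid: "?a i' * ?a (Suc j) \<le> ?a (Suc i) * ?a j'"
      proof (cases "i = j")
        case True
        then show ?thesis using i Suc by (simp add: mult.commute)
      next
        case False
        then have "i \<le> j'" using Cons.prems(2) Suc by simp
        then show ?thesis using IH[of i j'] IH[of i' j] i Suc by simp
      qed
      have "elem_sym (Suc i) (x # xs) * elem_sym j (x # xs) -
          elem_sym i (x # xs) * elem_sym (Suc j) (x # xs) =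
          (?a (Suc i) * ?a j - ?a i * ?a (Suc j)) + x * (?a (Suc i) * ?a j' - ?a i' * ?a (Suc j))
          + x * x * (?a i * ?a j' - ?a i' * ?a j)"
        unfolding i Suc elem_sym_Cons by (simp add: algebra_simps)
      moreover have "0 \<le> \<dots>"
        using IH[of i j] mid IH[of i' j'] x Cons.prems(2) i Suc
        by (intro add_nonneg_nonneg mult_nonneg_nonneg) auto
      ultimately show ?thesis by simp
    qed
  qed
qed

lemma elem_sym_replicate_1: "elem_sym k (replicate n 1) = real (n choose k)"
proof -
  have "elem_sym k (replicate n 1) = (\<Sum>I | I \<subseteq> {..<n} \<and> card I = k. 1)"
    unfolding elem_sym_def by (intro sum.cong) (auto intro!: prod.neutral simp: subset_iff)
  then show ?thesis by (simp add: n_subsets)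
qed

text \<open>If \<open>E\<^sub>K \<noteq> 0\<close>, log-concavity makes \<open>E\<^sub>K t\<^sup>K\<close> the largest term of the generating polynomial
  at \<open>t = E\<^bsub>K-1\<^esub> / E\<^sub>K\<close>, and \<open>u = s / t\<close> works. If \<open>E\<^sub>K = 0\<close>, all later terms vanish
  as well, and any small \<open>u\<close> works.\<close>

lemma elem_sym_dominant_term:
  fixes s \<delta> :: real
  assumes xs: "\<forall>x\<in>set xs. 0 \<le> x" and K: "1 \<le> K" "K \<le> length xs" and s: "0 < s" and \<delta>: "0 < \<delta>"
  shows "\<exists>u>0. (\<Prod>x\<leftarrow>xs. s * x + u) \<le>
    ((real (length xs) + 1) * elem_sym K xs * s ^ K + \<delta>) * u ^ (length xs - K)"
proof -
  let ?N = "length xs"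
  let ?a = "\<lambda>i. elem_sym i xs"
  have a: "0 \<le> ?a i" for i using xs by (rule elem_sym_nonneg)
  note lc = elem_sym_log_concave[OF xs]
  obtain K' where K': "K = Suc K'" using K by (cases K) auto
  show ?thesis
  proof (cases "?a K = 0")
    case True
    have zero: "?a j = 0" if "K \<le> j" for j
      using that
    proof (induction rule: dec_induct)
      case base
      then show ?case by (rule True)
    next
      case (step j)
      then show ?case using lc[of 0 j] a[of "Suc j"] by (simp add: elem_sym_0)
    qed
    define S where "S = (\<Sum>j<K. ?a j * s ^ j)"
    have S: "0 \<le> S" unfolding S_def using a s by (intro sum_nonneg) auto
    \<comment> \<open>Since \<open>u \<le> 1\<close>, each index below \<open>K\<close> contributes
      at least one factor \<open>u\<close> beyond \<open>u ^ (?N - K)\<close>; the denominator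
      \<open>S + 1\<close> makes \<open>S * u \<le> \<delta>\<close> and avoids a division by
      zero.\<close>
    define u where "u = min 1 (\<delta> / (S + 1))"
    have u: "0 < u" "u \<le> 1" using S \<delta> by (auto simp: u_def)
    have "u \<le> \<delta> / (S + 1)" by (simp add: u_def)
    then have "u * (S + 1) \<le> \<delta>" using S by (simp add: pos_le_divide_eq)
    then have Su: "S * u \<le> \<delta>" using u by (simp add: algebra_simps)
    have "(\<Prod>x\<leftarrow>xs. s * x + u) = (\<Sum>j<K. ?a j * s ^ j * u ^ (?N - j))"
      unfolding prod_list_eq_sum_elem_sym using K zero
      by (intro sum.mono_neutral_right) (auto simp: not_less)
    also have "\<dots> \<le> (\<Sum>j<K. ?a j * s ^ j * u ^ Suc (?N - K))"
    proof (intro sum_mono mult_left_mono power_decreasing)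
      fix j assume "j \<in> {..<K}"
      then show "Suc (?N - K) \<le> ?N - j" using K by auto
    qed (use u a s in auto)
    also have "\<dots> = S * u * u ^ (?N - K)"
      by (simp add: S_def sum_distrib_right sum_distrib_left mult_ac)
    also have "\<dots> \<le> \<delta> * u ^ (?N - K)" using Su u by (intro mult_right_mono) auto
    finally show ?thesis using u True by auto
  next
    case False
    then have aK: "0 < ?a K" using a[of K] by simp
    \<comment> \<open>Comparison with index 0, where the polynomial is 1, shows that the numerator
      of \<open>t\<close> is nonzero.\<close>
    have "0 < ?a 1 * ?a K'" using lc[of 0 K'] aK unfolding K' by (simp add: elem_sym_0)
    then have aK': "0 < ?a K'" using a[of K'] a[of 1] by (auto simp: zero_less_mult_iff)
    define t where "t = ?a K' / ?a K"
    have t: "0 < t" using aK aK' by (simp add: t_def)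
    have left: "?a j * t ^ j \<le> ?a K * t ^ K" if "j \<le> K" for j
      using that
    proof (induction rule: inc_induct)
      case base
      then show ?case by simp
    next
      case (step j)
      have "?a j * ?a K \<le> ?a (Suc j) * ?a K'"
        using lc[of j K'] step unfolding K' by simp
      then have "?a j \<le> ?a (Suc j) * t" using aK by (simp add: t_def field_simps)
      then have "?a j * t ^ j \<le> ?a (Suc j) * t * t ^ j" using t by (intro mult_right_mono) auto
      then show ?case using step by (simp add: mult_ac)
    qed
    have right: "?a j * t ^ j \<le> ?a K * t ^ K" if "K \<le> j" for j
      using that
    proof (induction rule: dec_induct)
      case base
      then show ?case by simp
    next
      case (step j)
      have "?a K' * ?a (Suc j) \<le> ?a K * ?a j"
        using lc[of K' j] step unfolding K' by simp
      then have "?a (Suc j) * t \<le> ?a j" using aK by (simp add: t_def field_simps)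
      then have "?a (Suc j) * t * t ^ j \<le> ?a j * t ^ j" using t by (intro mult_right_mono) auto
      then show ?case using step by (simp add: mult_ac)
    qed
    define u where "u = s / t"
    have u: "0 < u" "s = t * u" using s t by (auto simp: u_def)
    \<comment> \<open>By homogeneity all terms share the factor \<open>u ^ ?N\<close>, so only the
      numbers \<open>?a j * t ^ j\<close> remain to be compared.\<close>
    have pw: "s ^ j * u ^ (?N - j) = t ^ j * u ^ ?N" if "j \<le> ?N" for j
      using that by (simp add: u(2) power_mult_distrib mult.assoc power_add[symmetric])
    have "(\<Prod>x\<leftarrow>xs. s * x + u) = (\<Sum>j\<le>?N. ?a j * t ^ j * u ^ ?N)"
      unfolding prod_list_eq_sum_elem_sym using pw by (intro sum.cong) (auto simp: mult.assoc)
    also have "\<dots> \<le> (\<Sum>j\<le>?N. ?a K * t ^ K * u ^ ?N)"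
      using left right u by (intro sum_mono mult_right_mono) (auto, metis nle_le)
    also have "\<dots> = (real ?N + 1) * ?a K * (t ^ K * u ^ ?N)" by simp
    also have "\<dots> = (real ?N + 1) * ?a K * s ^ K * u ^ (?N - K)"
      using pw[OF K(2)] by (simp add: mult.assoc)
    also have "\<dots> \<le> ((real ?N + 1) * ?a K * s ^ K + \<delta>) * u ^ (?N - K)"
      using \<delta> u by (intro mult_right_mono) auto
    finally show ?thesis using u by blast
  qed
qed

section \<open>The HS mean of a tuple as an infimum of real roots\<close>

text \<open>This equivalence carries lower bounds through the exponential, and thereby through the
  infimum in the barycenter.\<close>

lemma ext_exp_le_iff:
  assumes "0 < r" shows "ereal r \<le> ext_exp z \<longleftrightarrow> ereal (ln r) \<le> z"
  using assms by (cases z) (auto simp: ext_exp_def ln_le_cancel_iff[of r "exp _", symmetric] simp del: ln_le_cancel_iff)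

lemma ext_integral_empirical_measure:
  assumes "xs \<noteq> []" and [measurable]: "f \<in> borel_measurable borel"
    and f: "\<And>x. x \<in> set xs \<Longrightarrow> f x = ereal (g x)"
  shows "ext_integral (empirical_measure xs) f = ereal ((\<Sum>x\<leftarrow>xs. g x) / real (length xs))"
proof -
  have s: "(\<Sum>x\<leftarrow>ys. ennreal (h x)) = ennreal (\<Sum>x\<leftarrow>ys. max 0 (h x))" for h :: "real \<Rightarrow> real" and ys
  proof -
    have "ennreal (h x) = ennreal (max 0 (h x))" for x by (simp add: max_def ennreal_neg)
    then show ?thesis by (simp del: ennreal_max_0)
  qed
  have i: "enn2ereal (\<integral>\<^sup>+ x. e2ennreal (F x) \<partial>empirical_measure xs)
      = ereal ((\<Sum>x\<leftarrow>xs. max 0 (h x)) / real (length xs))"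
    if [measurable]: "F \<in> borel_measurable borel" and F: "\<And>x. x \<in> set xs \<Longrightarrow> F x = ereal (h x)"
    for F h
  proof -
    have "0 \<le> (\<Sum>x\<leftarrow>ys. max 0 (h x))" for ys by (induction ys) auto
    moreover have "(\<Sum>x\<leftarrow>xs. e2ennreal (F x)) = (\<Sum>x\<leftarrow>xs. ennreal (h x))"
      using F by (intro arg_cong[where f=sum_list] map_cong) (auto simp: ennreal.abs_eq)
    ultimately show ?thesis using assms(1)
      by (simp add: nn_integral_empirical_measure s ennreal_of_nat_eq_real_of_nat divide_ennreal)
  qed
  have "(\<Sum>x\<leftarrow>ys. max 0 (g x)) - (\<Sum>x\<leftarrow>ys. max 0 (- g x)) = (\<Sum>x\<leftarrow>ys. g x)" for ys
    by (induction ys) auto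
  then show ?thesis
    unfolding ext_integral_def
    using i[of f g] i[of "\<lambda>x. - f x" "\<lambda>x. - g x"] f
    by (simp add: diff_divide_distrib[symmetric])
qed

text \<open>The positive part has a finite integral, while the single entry \<open>z\<close> makes
  that of the negative part infinite. This covers a zero entry when \<open>c = 1\<close>.\<close>

lemma ext_integral_empirical_measure_MInfty:
  assumes "xs \<noteq> []" and [measurable]: "f \<in> borel_measurable borel"
    and f: "\<And>x. x \<in> set xs \<Longrightarrow> f x < \<infinity>" and z: "z \<in> set xs" "f z = -\<infinity>"
  shows "ext_integral (empirical_measure xs) f = -\<infinity>"
proof -
  have "(\<Sum>x\<leftarrow>ys. e2ennreal (f x)) < top" if "set ys \<subseteq> set xs" for ys
    using that
  proof (induction ys)
    case (Cons y ys)
    then have "f y < \<infinity>" using f by auto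
    then have "e2ennreal (f y) < top" by (cases "f y") (auto simp: e2ennreal_neg)
    then show ?case using Cons by (auto simp: less_top)
  qed simp
  from this[of xs] have "(\<integral>\<^sup>+ x. e2ennreal (f x) \<partial>empirical_measure xs) < top"
    using assms(1) by (simp add: nn_integral_empirical_measure ennreal_divide_eq_top_iff less_top[symmetric])
  moreover have "(\<Sum>x\<leftarrow>xs. e2ennreal (- f x)) = top"
  proof -
    have "e2ennreal (- f z) \<le> (\<Sum>x\<leftarrow>xs. e2ennreal (- f x))"
      using z(1) by (intro member_le_sum_list) auto
    then show ?thesis using z(2) by (simp only:) (simp add: top_unique)
  qed
  then have "(\<integral>\<^sup>+ x. e2ennreal (- f x) \<partial>empirical_measure xs) = top"
    using assms(1) by (simp add: nn_integral_empirical_measure ennreal_top_divide)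
  ultimately show ?thesis
    unfolding ext_integral_def
    by (cases "\<integral>\<^sup>+ x. e2ennreal (f x) \<partial>empirical_measure xs") auto
qed

text \<open>The integral of the HS kernel against the empirical measure, multiplied by \<open>k\<close> and
  exponentiated, is \<open>y\<^sup>k \<Prod> (c x\<^sub>i / y + 1 - c)\<close> with \<open>c = k / n\<close>; here the factors
  are multiplied by \<open>y\<close>.\<close>

definition HS_objective :: "nat \<Rightarrow> real list \<Rightarrow> real \<Rightarrow> real" where
  "HS_objective k xs y =
     (\<Prod>x\<leftarrow>xs. (real k / real (length xs)) * x + (1 - real k / real (length xs)) * y)
       / y ^ (length xs - k)"

lemma prod_list_nonneg_real: "(\<And>x. x \<in> set xs \<Longrightarrow> 0 \<le> f x) \<Longrightarrow> 0 \<le> (\<Prod>x\<leftarrow>xs. f x :: real)"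
  by (induction xs) auto

lemma HS_objective_nonneg:
  assumes "\<forall>x\<in>set xs. 0 \<le> x" "k \<le> length xs" "0 < y"
  shows "0 \<le> HS_objective k xs y"
  unfolding HS_objective_def using assms
  by (intro divide_nonneg_nonneg prod_list_nonneg_real add_nonneg_nonneg mult_nonneg_nonneg)
    (auto simp: divide_simps)

lemma ext_exp_ext_integral_HS_kernel:
  assumes xs: "\<forall>x\<in>set xs. 0 \<le> x" and k: "1 \<le> k" "k \<le> length xs" and y: "0 < y"
  shows "ext_exp (ext_integral (empirical_measure xs)
      (\<lambda>x. HS_kernel x y (real k / real (length xs)))) = ereal (root k (HS_objective k xs y))"
proof -
  define n where "n = length xs"
  define c where "c = real k / real n"
  have n: "0 < n" "k \<le> n" "xs \<noteq> []" using k by (auto simp: n_def)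
  have c: "0 < c" "c \<le> 1" using k n by (auto simp: c_def)
  define p where "p x = c * inverse y * x + 1 - c" for x
  have p: "0 \<le> p x" if "x \<in> set xs" for x
    using that xs c y unfolding p_def by (simp add: add_increasing)
  have yp: "c * x + (1 - c) * y = y * p x" for x
    using y by (simp add: p_def field_simps)
  have K: "HS_kernel x y c = ereal (ln y) + ereal (inverse c) * ext_ln (p x)" for x
    using c by (simp add: HS_kernel_def p_def)
  have F: "HS_objective k xs y = (\<Prod>x\<leftarrow>xs. y * p x) / y ^ (n - k)"
    by (simp add: HS_objective_def yp n_def[symmetric] c_def[symmetric])
  show ?thesis
  proof (cases "\<exists>z\<in>set xs. p z = 0")
    \<comment> \<open>This happens only for \<open>c = 1\<close> and \<open>z = 0\<close>. The
      integral is then -\<infinity>, and both sides of the claim are 0.\<close>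
    case True
    then obtain z where z: "z \<in> set xs" "p z = 0" by blast
    have "ext_integral (empirical_measure xs) (\<lambda>x. HS_kernel x y c) = -\<infinity>"
      using z c n HS_kernel_measurable[of y c]
      by (intro ext_integral_empirical_measure_MInfty[of _ _ z]) (auto simp: K ext_ln_def)
    moreover have "(\<Prod>x\<leftarrow>xs. y * p x) = 0"
      using z by (induction xs) auto
    ultimately show ?thesis by (simp add: F ext_exp_def c_def n_def)
  next
    case False
    then have pos: "0 < p x" if "x \<in> set xs" for x using p that by (simp add: less_le)
    have prod: "0 < (\<Prod>x\<leftarrow>ys. y * p x)
        \<and> ln (\<Prod>x\<leftarrow>ys. y * p x) = length ys * ln y + (\<Sum>x\<leftarrow>ys. ln (p x))"
      if "set ys \<subseteq> set xs" for ys
      using that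
    proof (induction ys)
      case (Cons a ys)
      then show ?case using pos[of a] y by (simp add: ln_mult algebra_simps)
    qed simp
    have sum: "(\<Sum>x\<leftarrow>ys. ln y + inverse c * ln (p x)) = length ys * ln y + inverse c * (\<Sum>x\<leftarrow>ys. ln (p x))" for ys
      by (induction ys) (auto simp: algebra_simps)
    have "ext_integral (empirical_measure xs) (\<lambda>x. HS_kernel x y c)
        = ereal ((\<Sum>x\<leftarrow>xs. ln y + inverse c * ln (p x)) / n)"
      unfolding n_def using n HS_kernel_measurable[of y c]
      by (intro ext_integral_empirical_measure) (auto simp: K ext_ln_def dest: pos)
    \<comment> \<open>As \<open>c * n = k\<close>, both sides equal \<open>ln y\<close> plus the sum
      of the \<open>ln (p x)\<close> divided by \<open>k\<close>; the denominator
      \<open>y ^ (n - k)\<close> reduces \<open>n * ln y\<close> to \<open>k * ln y\<close>.\<close>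
    also have "(\<Sum>x\<leftarrow>xs. ln y + inverse c * ln (p x)) / n = ln (HS_objective k xs y) / k"
      unfolding sum using prod[of xs] k n y
      by (simp add: F ln_div ln_realpow n_def[symmetric] c_def of_nat_diff field_simps)
    finally have "ext_exp (ext_integral (empirical_measure xs) (\<lambda>x. HS_kernel x y c))
        = ereal (exp (ln (HS_objective k xs y) / k))"
      by (simp add: ext_exp_def)
    moreover have "0 < HS_objective k xs y" using prod[of xs] y by (simp add: F)
    ultimately show ?thesis using k
      by (simp add: root_powr_inverse powr_def c_def n_def)
  qed
qed

text \<open>The last two properties say that the real number \<open>h\<close> is the greatest lower
  bound of the roots, so later estimates stay within the reals.\<close>

lemma HS_mean_eq_INF:
  assumes xs: "\<forall>x\<in>set xs. 0 \<le> x" and k: "1 \<le> k" "k \<le> length xs"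
  obtains h where "0 \<le> h" "HS_mean (real k / real (length xs)) xs = ereal h"
    "\<forall>y>0. h \<le> root k (HS_objective k xs y)"
    "\<forall>z. (\<forall>y>0. z \<le> root k (HS_objective k xs y)) \<longrightarrow> z \<le> h"
proof -
  let ?g = "\<lambda>y. ext_integral (empirical_measure xs) (\<lambda>x. HS_kernel x y (real k / real (length xs)))"
  have "xs \<noteq> []" using k by auto
  then obtain h where h: "0 \<le> h" "HS_mean (real k / real (length xs)) xs = ereal h"
    using HS_mean_nonneg_finite[of xs "real k / real (length xs)"]
    by (cases "HS_mean (real k / real (length xs)) xs") auto
  have hI: "ext_exp (INF y\<in>{0<..}. ?g y) = ereal h"
    using h(2) by (simp add: HS_mean_def HS_barycenter_def)
  \<comment> \<open>Positivity of \<open>r\<close> is needed to take its logarithm; bounds by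
    nonpositive numbers follow from nonnegativity of the roots and of \<open>h\<close>.\<close>
  have iff: "r \<le> h \<longleftrightarrow> (\<forall>y>0. r \<le> root k (HS_objective k xs y))" if r: "0 < r" for r
  proof -
    have "r \<le> h \<longleftrightarrow> ereal (ln r) \<le> (INF y\<in>{0<..}. ?g y)"
      using ext_exp_le_iff[OF r, of "INF y\<in>{0<..}. ?g y"] hI by simp
    also have "\<dots> \<longleftrightarrow> (\<forall>y>0. ereal r \<le> ext_exp (?g y))"
      using ext_exp_le_iff[OF r] by (auto simp: le_INF_iff)
    finally show ?thesis using ext_exp_ext_integral_HS_kernel[OF xs k] by simp
  qed
  show thesis
  proof
    show "\<forall>y>0. h \<le> root k (HS_objective k xs y)"
      using iff[of h] h(1) HS_objective_nonneg[OF xs k(2)] k by (cases "h = 0") auto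
    show "\<forall>z. (\<forall>y>0. z \<le> root k (HS_objective k xs y)) \<longrightarrow> z \<le> h"
      using iff h(1) by (meson not_less order_trans)
  qed (use h in auto)
qed

section \<open>Repeated tuples and two-sided estimates for the term free of \<open>y\<close>\<close>

lemma prod_list_repeat_tuple: "(\<Prod>x\<leftarrow>repeat_tuple m xs. f x) = (\<Prod>x\<leftarrow>xs. f x :: real) ^ m"
  by (induction m) (simp_all add: repeat_tuple_def)

lemma length_repeat_tuple: "length (repeat_tuple m xs) = length xs * m"
  by (induction m) (simp_all add: repeat_tuple_def)

lemma set_repeat_tuple: "set (repeat_tuple m xs) \<subseteq> set xs"
  by (induction m) (auto simp: repeat_tuple_def)

lemma repeat_tuple_replicate: "repeat_tuple m (replicate n a) = replicate (n * m) a"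
  by (induction m) (simp_all add: repeat_tuple_def replicate_add[symmetric])

lemma HS_objective_power:
  "HS_objective k xs y ^ m =
    (\<Prod>x\<leftarrow>repeat_tuple m xs. (real k / real (length xs)) * x + (1 - real k / real (length xs)) * y)
      / y ^ (length xs * m - k * m)"
  by (simp add: HS_objective_def prod_list_repeat_tuple power_divide power_mult[symmetric]
      diff_mult_distrib)

text \<open>All terms of the expansion are nonnegative, and in the one of index \<open>k * m\<close>
  the power of \<open>y\<close> cancels against the denominator.\<close>

lemma elem_sym_repeat_tuple_le:
  fixes c :: real
  assumes xs: "\<forall>x\<in>set xs. 0 \<le> x" and k: "1 \<le> k" "k \<le> length xs" and y: "0 < y"
  defines "c \<equiv> real k / real (length xs)"
  shows "elem_sym (k * m) (repeat_tuple m xs) * (c ^ (k * m) * (1 - c) ^ (length xs * m - k * m))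
    \<le> HS_objective k xs y ^ m"
proof -
  let ?X = "repeat_tuple m xs" and ?N = "length xs * m" and ?K = "k * m"
  have c: "0 \<le> c" "c \<le> 1" using k by (auto simp: c_def divide_simps)
  have X: "\<forall>x\<in>set ?X. 0 \<le> x" using xs set_repeat_tuple[of m xs] by blast
  have "elem_sym ?K ?X * c ^ ?K * ((1 - c) * y) ^ (?N - ?K) \<le> (\<Prod>x\<leftarrow>?X. c * x + (1 - c) * y)"
    unfolding prod_list_eq_sum_elem_sym length_repeat_tuple
    using c y k elem_sym_nonneg[OF X]
    by (intro member_le_sum[where i="?K" and f="\<lambda>j. elem_sym j ?X * c ^ j * ((1 - c) * y) ^ (?N - j)"]) auto
  then show ?thesis
    unfolding HS_objective_power c_def[symmetric] using y
    by (simp add: pos_le_divide_eq power_mult_distrib mult_ac)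
qed

text \<open>This converse estimate rests on \<open>elem_sym_dominant_term\<close>. The slack
  \<delta> allows for an infimum that is not attained.\<close>

lemma HS_objective_power_le:
  fixes c \<delta> :: real
  assumes xs: "\<forall>x\<in>set xs. 0 \<le> x" and k: "1 \<le> k" "k \<le> length xs" and m: "1 \<le> m" and \<delta>: "0 < \<delta>"
  defines "c \<equiv> real k / real (length xs)"
  shows "\<exists>y>0. HS_objective k xs y ^ m \<le> (real (length xs * m) + 1) *
    (elem_sym (k * m) (repeat_tuple m xs) * (c ^ (k * m) * (1 - c) ^ (length xs * m - k * m))) + \<delta>"
proof -
  let ?X = "repeat_tuple m xs" and ?N = "length xs * m" and ?K = "k * m"
  have c: "0 < c" "c \<le> 1" using k by (auto simp: c_def divide_simps)
  have X: "\<forall>x\<in>set ?X. 0 \<le> x" using xs set_repeat_tuple[of m xs] by blast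
  note F = HS_objective_power[of k xs _ m, folded c_def]
  show ?thesis
  proof (cases "k = length xs")
    \<comment> \<open>Here \<open>1 - c = 0\<close>, so no choice of \<open>y\<close> can produce a
      positive \<open>u\<close>; but the objective no longer depends on \<open>y\<close>, and its
      power is the top elementary symmetric polynomial.\<close>
    case True
    have "0 < length xs" using k by linarith
    with True have c1: "c = 1" by (simp add: c_def)
    have "(\<Prod>x\<leftarrow>?X. 1 * x + 0) = elem_sym ?N ?X"
      unfolding prod_list_eq_sum_elem_sym length_repeat_tuple
      by (subst sum.remove[of _ ?N]) (auto intro!: sum.neutral simp: power_0_left)
    then have "HS_objective k xs 1 ^ m = elem_sym ?N ?X" by (simp add: F c1)
    moreover have "elem_sym ?N ?X \<le> (real ?N + 1) * elem_sym ?N ?X"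
      using elem_sym_nonneg[OF X, of ?N] by (simp add: algebra_simps)
    ultimately show ?thesis
      using \<delta> True by (intro exI[of _ 1]) (simp add: c1)
  next
    case False
    then have c': "c < 1" using k by (simp add: c_def divide_simps)
    have "1 \<le> ?K" "?K \<le> length ?X" using k m by (simp_all add: length_repeat_tuple)
    from elem_sym_dominant_term[OF X this c(1) \<delta>]
    obtain u where u: "0 < u" "(\<Prod>x\<leftarrow>?X. c * x + u) \<le>
        ((real ?N + 1) * elem_sym ?K ?X * c ^ ?K + \<delta>) * u ^ (?N - ?K)"
      by (auto simp: length_repeat_tuple)
    define y where "y = u / (1 - c)"
    have y: "0 < y" "u = (1 - c) * y" using u c' by (auto simp: y_def)
    have "HS_objective k xs y ^ m \<le>
        ((real ?N + 1) * elem_sym ?K ?X * c ^ ?K + \<delta>) * (1 - c) ^ (?N - ?K)"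
      using u(2) y by (simp add: F pos_divide_le_eq power_mult_distrib mult_ac)
    \<comment> \<open>The factor \<open>(1 - c) ^ (?N - ?K)\<close> is at most 1, so the slack does
      not grow.\<close>
    also have "\<dots> \<le> (real ?N + 1) * (elem_sym ?K ?X * (c ^ ?K * (1 - c) ^ (?N - ?K))) + \<delta>"
      using \<delta> c c' by (simp add: algebra_simps mult_le_cancel_left2 power_le_one)
    finally show ?thesis using y by blast
  qed
qed

text \<open>This is the weighted AM-GM inequality for 1 and \<open>y\<close> with weights
  \<open>c\<close> and \<open>1 - c\<close>, raised to the power \<open>n\<close>.\<close>

lemma HS_objective_ones:
  assumes k: "1 \<le> k" "k \<le> n" and y: "0 < y"
  shows "1 \<le> HS_objective k (replicate n 1) y"
proof -
  define c where "c = real k / real n"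
  have c: "0 \<le> c" "c \<le> 1" "(1 - c) * n = real (n - k)" using k by (auto simp: c_def field_simps of_nat_diff)
  have "y powr (1 - c) \<le> c + (1 - c) * y"
    using Youngs_inequality_0[of c "1 - c" 1 y] c y by simp
  then have "(y powr (1 - c)) ^ n \<le> (c + (1 - c) * y) ^ n"
    by (intro power_mono) auto
  moreover have "(y powr (1 - c)) ^ n = y ^ (n - k)"
    using y c(3) by (simp add: powr_realpow[symmetric] powr_powr)
  ultimately show ?thesis
    using y by (simp add: HS_objective_def c_def[symmetric] map_replicate prod_list_replicate
        pos_le_divide_eq)
qed

text \<open>Both bounds are the tuple estimates applied to \<open>(1, \<dots>, 1)\<close>, whose elementary symmetric
  polynomials are binomial coefficients and whose HS mean is 1.\<close>

lemma binomial_prob_bounds: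
  fixes c :: real
  assumes k: "1 \<le> k" "k \<le> n" and m: "1 \<le> m"
  defines "c \<equiv> real k / real n"
  defines "B \<equiv> real ((n * m) choose (k * m)) * (c ^ (k * m) * (1 - c) ^ (n * m - k * m))"
  shows "B \<le> 1" "1 \<le> (real (n * m) + 1) * B"
proof -
  let ?o = "replicate n (1::real)"
  have E: "elem_sym (k * m) (repeat_tuple m ?o) = real ((n * m) choose (k * m))"
    by (simp add: repeat_tuple_replicate elem_sym_replicate_1)
  have "HS_objective k ?o 1 = 1"
    by (simp add: HS_objective_def map_replicate prod_list_replicate)
  then show "B \<le> 1"
    using elem_sym_repeat_tuple_le[of ?o k 1 m] k by (simp add: E B_def c_def)
  show "1 \<le> (real (n * m) + 1) * B"
  proof (rule field_le_epsilon)
    fix \<delta> :: real assume "0 < \<delta>"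
    then obtain y where "0 < y" "HS_objective k ?o y ^ m \<le> (real (n * m) + 1) * B + \<delta>"
      using HS_objective_power_le[of ?o k m \<delta>] k m by (auto simp: E B_def c_def)
    moreover have "1 \<le> HS_objective k ?o y ^ m"
      using HS_objective_ones[OF k \<open>0 < y\<close>] by simp
    ultimately show "1 \<le> (real (n * m) + 1) * B + \<delta>" by linarith
  qed
qed

section \<open>Comparison of the two means and passage to the limit\<close>

text \<open>With \<open>K = k * m\<close>, the term free of \<open>y\<close> is the
  \<open>K\<close>-th power of the symmetric mean times a binomial probability. The errors of the
  tuple estimates and of that probability are at most \<open>real (length xs * m) + 1\<close>, whose
  \<open>K\<close>-th root is bounded by \<open>q\<close>.\<close>

lemma sym_mean_HS_mean_bounds:
  assumes xs: "\<forall>x\<in>set xs. 0 \<le> x" and k: "1 \<le> k" "k \<le> length xs" and m: "1 \<le> m"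
    and q: "0 < q" "real (length xs * m) + 1 \<le> q ^ (k * m)"
  obtains h where "HS_mean (real k / real (length xs)) xs = ereal h"
    "sym_mean (k * m) (repeat_tuple m xs) \<le> q * h"
    "h \<le> q * sym_mean (k * m) (repeat_tuple m xs)"
proof -
  define n where "n = length xs"
  let ?X = "repeat_tuple m xs"
  define N K where "N = n * m" and "K = k * m"
  define c where "c = real k / real n"
  define w where "w = c ^ K * (1 - c) ^ (N - K)"
  define e where "e = elem_sym K ?X"
  define B where "B = real (N choose K) * w"
  define S where "S = sym_mean K ?X"
  obtain h where h: "0 \<le> h" "HS_mean (real k / real (length xs)) xs = ereal h"
    "\<forall>y>0. h \<le> root k (HS_objective k xs y)"
    "\<forall>z. (\<forall>y>0. z \<le> root k (HS_objective k xs y)) \<longrightarrow> z \<le> h"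
    using HS_mean_eq_INF[OF xs k] by blast
  have K: "0 < K" "K \<le> N" using k m by (auto simp: K_def N_def n_def)
  have e: "0 \<le> e" unfolding e_def using xs set_repeat_tuple[of m xs] by (intro elem_sym_nonneg) blast
  have B: "B \<le> 1" "1 \<le> (real N + 1) * B"
    using binomial_prob_bounds[OF k m] by (auto simp: B_def w_def c_def n_def N_def K_def)
  have S: "0 \<le> S" "S ^ K = e / real (N choose K)"
    using K e by (auto simp: S_def sym_mean_def length_repeat_tuple e_def N_def n_def)
  have ew: "e * w = B * S ^ K"
    using K by (simp add: S(2) B_def)
  have root: "root k (HS_objective k xs y) ^ K = HS_objective k xs y ^ m" if "0 < y" for y
    using HS_objective_nonneg[OF xs k(2) that] k by (simp add: K_def power_mult)
  show thesis
  proof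
    show "HS_mean (real k / real (length xs)) xs = ereal h" by fact
    have "S / q \<le> root k (HS_objective k xs y)" if y: "0 < y" for y
    proof -
      \<comment> \<open>This direction uses the lower bound on the binomial probability
        \<open>B\<close>.\<close>
      have "1 * S ^ K \<le> ((real N + 1) * B) * S ^ K"
        using B(2) S(1) by (intro mult_right_mono zero_le_power)
      also have "\<dots> = (real N + 1) * (e * w)" by (simp add: ew)
      also have "\<dots> \<le> (real N + 1) * HS_objective k xs y ^ m"
        using elem_sym_repeat_tuple_le[OF xs k y, of m]
        by (intro mult_left_mono) (auto simp: e_def w_def c_def n_def N_def K_def)
      also have "\<dots> \<le> q ^ K * HS_objective k xs y ^ m"
        using q HS_objective_nonneg[OF xs k(2) y]
        by (intro mult_right_mono) (auto simp: N_def K_def n_def)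
      also have "\<dots> = (q * root k (HS_objective k xs y)) ^ K"
        by (simp add: root[OF y] power_mult_distrib)
      finally have "S \<le> q * root k (HS_objective k xs y)"
        using K q HS_objective_nonneg[OF xs k(2) y] k
        by (intro power_le_imp_le_base[of S "K - 1"]) auto
      then show ?thesis using q by (simp add: pos_divide_le_eq mult.commute)
    qed
    then have "S / q \<le> h" using h(4) by blast
    then show "sym_mean (k * m) ?X \<le> q * h"
      using q by (simp add: S_def K_def pos_divide_le_eq mult.commute)
    have "h ^ K \<le> (real N + 1) * (e * w)"
    proof (rule field_le_epsilon)
      fix \<delta> :: real assume "0 < \<delta>"
      then obtain y where y: "0 < y" "HS_objective k xs y ^ m \<le> (real N + 1) * (e * w) + \<delta>"
        using HS_objective_power_le[OF xs k m] by (auto simp: e_def w_def c_def n_def N_def K_def)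
      have "h ^ K \<le> root k (HS_objective k xs y) ^ K"
        using h y by (intro power_mono) auto
      then show "h ^ K \<le> (real N + 1) * (e * w) + \<delta>" using y root by simp
    qed
    also have "\<dots> = B * ((real N + 1) * S ^ K)" by (simp add: ew)
    \<comment> \<open>Here the upper bound \<open>B \<le> 1\<close> enters.\<close>
    also have "\<dots> \<le> 1 * (q ^ K * S ^ K)"
    proof (intro mult_mono mult_right_mono)
      show "real N + 1 \<le> q ^ K" using q(2) by (simp add: N_def K_def n_def)
    qed (use B(1) S(1) q(1) in \<open>auto intro!: mult_nonneg_nonneg zero_le_power\<close>)
    finally have "h ^ K \<le> (q * S) ^ K" by (simp add: power_mult_distrib)
    then show "h \<le> q * sym_mean (k * m) ?X"
      using K q S by (intro power_le_imp_le_base[of h "K - 1"]) (auto simp: S_def K_def)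
  qed
qed

theorem theorem3p1:
  fixes n k :: nat
  assumes "1 \<le> k" and "k \<le> n"
  shows "(\<forall>xs :: real list. length xs = n \<and> (\<forall>x\<in>set xs. 0 \<le> x) \<longrightarrow>
            (\<lambda>m. ereal (sym_mean (k * m) (repeat_tuple m xs)))
              \<longlonglongrightarrow> HS_mean (real k / real n) xs)
       \<and> (\<forall>\<epsilon> :: real. \<epsilon> > 0 \<longrightarrow> (\<exists>M\<ge>1. \<forall>m\<ge>M. \<forall>xs :: real list.
            length xs = n \<and> (\<forall>x\<in>set xs. 0 \<le> x) \<longrightarrow>
            \<bar>ereal (sym_mean (k * m) (repeat_tuple m xs)) - HS_mean (real k / real n) xs\<bar>
              \<le> ereal \<epsilon> * HS_mean (real k / real n) xs))"
proof -
  \<comment> \<open>This is the \<open>m\<close>-th root of \<open>(n + 1) * m\<close>, which is at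
    least \<open>n * m + 1\<close> for \<open>m \<ge> 1\<close>; splitting it gives two standard
    limits. Since \<open>q m \<ge> 1\<close>, raising it to \<open>k * m\<close> instead of
    \<open>m\<close> only helps.\<close>
  define q where "q m = root m (real (n + 1)) * root m (real m)" for m
  have "q \<longlonglongrightarrow> 1 * 1"
    unfolding q_def by (intro tendsto_mult LIMSEQ_root LIMSEQ_root_const) auto
  then have q_lim: "q \<longlonglongrightarrow> 1" by simp
  have bound: "\<bar>ereal (sym_mean (k * m) (repeat_tuple m xs)) - HS_mean (real k / real n) xs\<bar>
      \<le> ereal (q m - 1) * HS_mean (real k / real n) xs"
    and fin: "\<bar>HS_mean (real k / real n) xs\<bar> \<noteq> \<infinity>"
    if m: "1 \<le> m" and xs: "length xs = n" "\<forall>x\<in>set xs. 0 \<le> x" for m xs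
  proof -
    have pow: "q m ^ m = real ((n + 1) * m)"
      using m by (simp add: q_def power_mult_distrib algebra_simps)
    have q1: "1 \<le> q m"
      using m mult_mono[of 1 "root m (real (n + 1))" 1 "root m (real m)"] by (simp add: q_def)
    have "real (length xs * m) + 1 \<le> q m ^ m"
      using m xs unfolding pow by simp
    also have "\<dots> \<le> q m ^ (k * m)"
      using q1 assms by (intro power_increasing) auto
    finally have q: "real (length xs * m) + 1 \<le> q m ^ (k * m)" .
    define S where "S = sym_mean (k * m) (repeat_tuple m xs)"
    obtain h where h: "HS_mean (real k / real n) xs = ereal h" "S \<le> q m * h" "h \<le> q m * S"
      using sym_mean_HS_mean_bounds[OF xs(2) assms(1) _ m _ q] q1 xs assms by (auto simp: S_def)
    have "xs \<noteq> []" using xs assms by auto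
    then have h0: "0 \<le> h" using HS_mean_nonneg_finite(1)[of xs "real k / real n"] h(1) by simp
    \<comment> \<open>The bound \<open>h \<le> q m * S\<close> gives the relative error
      \<open>1 - 1 / q m\<close>, which is at most \<open>q m - 1\<close> because
      \<open>q m * (2 - q m) \<le> 1\<close>. One constant thus serves both signs.\<close>
    have "h \<le> S + (q m - 1) * h"
    proof -
      have "0 \<le> (q m - 1) ^ 2 * h" using h0 by simp
      then have "h * (2 - q m) * q m \<le> h" by (simp add: power2_eq_square algebra_simps)
      then have "q m * (h * (2 - q m)) \<le> q m * S" using h(3) by (simp add: mult_ac)
      then have "h * (2 - q m) \<le> S" using q1 by simp
      then show ?thesis by (simp add: algebra_simps)
    qed
    then have "\<bar>S - h\<bar> \<le> (q m - 1) * h" using h(2) by (simp add: abs_le_iff algebra_simps)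
    then show "\<bar>ereal (sym_mean (k * m) (repeat_tuple m xs)) - HS_mean (real k / real n) xs\<bar>
        \<le> ereal (q m - 1) * HS_mean (real k / real n) xs"
      by (simp add: h(1) S_def)
    show "\<bar>HS_mean (real k / real n) xs\<bar> \<noteq> \<infinity>" by (simp add: h(1))
  qed
  have lim: "(\<lambda>m. ereal (sym_mean (k * m) (repeat_tuple m xs))) \<longlonglongrightarrow> HS_mean (real k / real n) xs"
    if xs: "length xs = n" "\<forall>x\<in>set xs. 0 \<le> x" for xs
  proof -
    \<comment> \<open>The premise of \<open>fin\<close> on \<open>m\<close> is met by
      \<open>m = 1\<close>.\<close>
    obtain h where h: "HS_mean (real k / real n) xs = ereal h"
      using fin[OF order_refl xs] by (cases "HS_mean (real k / real n) xs") auto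
    have "(\<lambda>m. sym_mean (k * m) (repeat_tuple m xs) - h) \<longlonglongrightarrow> 0"
    proof (rule Lim_null_comparison)
      show "\<forall>\<^sub>F m in sequentially. norm (sym_mean (k * m) (repeat_tuple m xs) - h) \<le> (q m - 1) * h"
        using eventually_ge_at_top[of 1]
      proof eventually_elim
        case (elim m)
        show ?case using bound[OF elim xs] by (simp add: h)
      qed
      show "(\<lambda>m. (q m - 1) * h) \<longlonglongrightarrow> 0"
        using tendsto_mult_right[OF tendsto_diff[OF q_lim tendsto_const[of 1]], of h] by simp
    qed
    then show ?thesis by (simp add: h LIM_zero_iff)
  qed
  have unif: "\<exists>M\<ge>1. \<forall>m\<ge>M. \<forall>xs. length xs = n \<and> (\<forall>x\<in>set xs. 0 \<le> x) \<longrightarrow>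
      \<bar>ereal (sym_mean (k * m) (repeat_tuple m xs)) - HS_mean (real k / real n) xs\<bar>
        \<le> ereal \<epsilon> * HS_mean (real k / real n) xs" if \<epsilon>: "0 < \<epsilon>" for \<epsilon>
  proof -
    have "\<forall>\<^sub>F m in sequentially. q m < 1 + \<epsilon>"
      using order_tendstoD(2)[OF q_lim, of "1 + \<epsilon>"] \<epsilon> by simp
    then obtain M where M: "\<And>m. M \<le> m \<Longrightarrow> q m < 1 + \<epsilon>"
      by (auto simp: eventually_sequentially)
    show ?thesis
    proof (intro exI[of _ "max 1 M"] conjI allI impI)
      fix m and xs :: "real list"
      assume m: "max 1 M \<le> m" and "length xs = n \<and> (\<forall>x\<in>set xs. 0 \<le> x)"
      then have xs: "length xs = n" "\<forall>x\<in>set xs. 0 \<le> x" by auto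
      have "xs \<noteq> []" using xs assms by auto
      then have "0 \<le> HS_mean (real k / real n) xs" by (rule HS_mean_nonneg_finite)
      then have "ereal (q m - 1) * HS_mean (real k / real n) xs \<le> ereal \<epsilon> * HS_mean (real k / real n) xs"
        using M[of m] m by (intro ereal_mult_right_mono) auto
      then show "\<bar>ereal (sym_mean (k * m) (repeat_tuple m xs)) - HS_mean (real k / real n) xs\<bar>
          \<le> ereal \<epsilon> * HS_mean (real k / real n) xs"
        using bound[OF _ xs, of m] m by (auto intro: order_trans)
    qed simp
  qed
  show ?thesis using lim unif by blast
qed

end
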